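(* Let $f:\mathbb{R}^n\to\mathbb{R}^n$ be a continuous $d$-demicontractive mapping for some $d\in[0,1)$, and let $\ell:\mathbb{R}^n\to\mathbb{R}$ be a proper, convex, lower semicontinuous, differentiable function whose gradient $\nabla\ell$ is $L$-Lipschitz, $L>0$. Assume: (1) $\alpha\in\left(0,\frac{1-d}{2}\right)$; (2) $\mu\in\left(0,\frac{2}{L}\right)$; (3) $\mathrm{Fix}(f)\cap\mathrm{Fix}(G_\ell)\neq\emptyset$, where $G_\ell=\mathrm{Id}-\mu\nabla\ell$. Then, for any $\mathbf{x}_0\in\mathbb{R}^n$, the sequence $\{\mathbf{x}_k\}_{k\in\mathbb{N}}$ generated by $$\mathbf{x}_{k+1}=f_\alpha\big(\mathbf{x}_k-\mu\nabla\ell(\mathbf{x}_k)\big),\qquad f_\alpha=\alpha f+(1-\alpha)\mathrm{Id},$$ converges to an optimal solution of the problem $\min_{\mathbf{x}\in\mathbb{R}^n}\ell(\mathbf{x})$ subject to $\mathbf{x}\in\mathrm{Fix}(f)$.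
   Context: $\|\cdot\|$ is the Euclidean norm on $\mathbb{R}^n$ and $\mathrm{Id}$ is the identity. For $T:\mathbb{R}^n\to\mathbb{R}^n$, $\mathrm{Fix}(T)=\{\mathbf{x}\in\mathbb{R}^n: T(\mathbf{x})=\mathbf{x}\}$. The mapping $T$ is $d$-demicontractive, $d\in[0,1)$, if for all $\mathbf{x}\in\mathbb{R}^n$ and all $\mathbf{z}\in\mathrm{Fix}(T)$, $$\|T(\mathbf{x})-\mathbf{z}\|^2\le\|\mathbf{x}-\mathbf{z}\|^2+d\,\|T(\mathbf{x})-\mathbf{x}\|^2 .$$ *)

theory Defs
  imports "HOL-Analysis.Analysis"
begin

definition Fix :: "('a \<Rightarrow> 'a) \<Rightarrow> 'a set" where
  "Fix T = {x. T x = x}"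

definition demicontractive :: "real \<Rightarrow> ('a::real_normed_vector \<Rightarrow> 'a) \<Rightarrow> bool" where
  "demicontractive d T \<longleftrightarrow> 0 \<le> d \<and> d < 1 \<and>
     (\<forall>x. \<forall>z\<in>Fix T. (norm (T x - z))\<^sup>2 \<le> (norm (x - z))\<^sup>2 + d * (norm (T x - x))\<^sup>2)"

text \<open>Properness and lower semicontinuity are the convex-analysis notions for extended-real-valued
  functions; a real-valued function is regarded as one via \<^const>\<open>ereal\<close>. Properness is
  then automatic.\<close>

definition proper_fun :: "('a \<Rightarrow> ereal) \<Rightarrow> bool" where
  "proper_fun F \<longleftrightarrow> (\<forall>x. F x \<noteq> -\<infinity>) \<and> (\<exists>x. F x < \<infinity>)"

definition lower_semicontinuous :: "('a::topological_space \<Rightarrow> ereal) \<Rightarrow> bool" where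
  "lower_semicontinuous F \<longleftrightarrow> (\<forall>x. F x \<le> Liminf (at x) F)"

text \<open>The gradient is meaningful only at points of differentiability, where
  \<open>gradient_works\<close> below applies.\<close>

definition gradient :: "('a::real_inner \<Rightarrow> real) \<Rightarrow> 'a \<Rightarrow> 'a" where
  "gradient l x = (THE D. GDERIV l x :> D)"

lemma GDERIV_imp_gradient:
  assumes "GDERIV l x :> D"
  shows "gradient l x = D"
  unfolding gradient_def
proof (rule the_equality)
  show "GDERIV l x :> D" by fact
next
  fix E assume E: "GDERIV l x :> E"
  have "(\<lambda>h. h \<bullet> E) = (\<lambda>h. h \<bullet> D)"
    by (rule has_derivative_unique[OF E[unfolded gderiv_def] assms[unfolded gderiv_def]])
  then have "(E - D) \<bullet> E = (E - D) \<bullet> D"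
    by (rule fun_cong)
  then have "(E - D) \<bullet> (E - D) = 0"
    by (simp add: inner_diff_right)
  then show "E = D"
    by simp
qed

lemma gradient_works:
  fixes l :: "'a::euclidean_space \<Rightarrow> real"
  assumes "l differentiable at x"
  shows "GDERIV l x :> gradient l x"
proof -
  obtain l' where l': "(l has_derivative l') (at x)"
    using assms unfolding differentiable_def by blast
  interpret linear l'
    using l' by (rule has_derivative_linear)
  have "l' h = h \<bullet> (\<Sum>b\<in>Basis. l' b *\<^sub>R b)" for h
  proof -
    have "l' h = l' (\<Sum>b\<in>Basis. (h \<bullet> b) *\<^sub>R b)"
      by (simp add: euclidean_representation)
    also have "\<dots> = h \<bullet> (\<Sum>b\<in>Basis. l' b *\<^sub>R b)"
      by (simp add: sum scale inner_sum_right mult.commute)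
    finally show ?thesis .
  qed
  then have "l' = (\<lambda>h. h \<bullet> (\<Sum>b\<in>Basis. l' b *\<^sub>R b))" by blast
  with l' have "GDERIV l x :> (\<Sum>b\<in>Basis. l' b *\<^sub>R b)"
    unfolding gderiv_def by simp
  then show ?thesis
    by (simp add: GDERIV_imp_gradient)
qed

definition gradient_step :: "real \<Rightarrow> ('a::real_inner \<Rightarrow> real) \<Rightarrow> 'a \<Rightarrow> 'a" where
  "gradient_step \<mu> l x = x - \<mu> *\<^sub>R gradient l x"

definition relaxation :: "real \<Rightarrow> ('a::real_vector \<Rightarrow> 'a) \<Rightarrow> 'a \<Rightarrow> 'a" where
  "relaxation \<alpha> T x = \<alpha> *\<^sub>R T x + (1 - \<alpha>) *\<^sub>R x"

end

theory Submission
  imports Defs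
begin

text \<open>Every common fixed point \<open>z\<close> is a critical point of \<open>l\<close>. Cocoercivity of the gradient
  (Baillon--Haddad) for the gradient step and demicontractivity for the relaxed \<open>f\<close>-step show that
  \<open>\<parallel>x\<^sub>k - z\<parallel>\<^sup>2\<close> decreases by at least a fixed positive combination of \<open>\<parallel>\<nabla>l(x\<^sub>k)\<parallel>\<^sup>2\<close> and
  \<open>\<parallel>f(y\<^sub>k) - y\<^sub>k\<parallel>\<^sup>2\<close>, where \<open>y\<^sub>k\<close> is the intermediate point. Both residuals therefore vanish, so by
  continuity every cluster point is again a common fixed point, and Fejer monotonicity with
  respect to it turns subsequential convergence into convergence. Critical points of a convex
  function are global minimisers.\<close>

lemma GDERIV_along_line:
  assumes "GDERIV l (x + t *\<^sub>R h) :> D"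
  shows "((\<lambda>t. l (x + t *\<^sub>R h)) has_real_derivative h \<bullet> D) (at t)"
proof -
  have "((\<lambda>t. x + t *\<^sub>R h) has_derivative (\<lambda>s. s *\<^sub>R h)) (at t)"
    by (auto intro!: derivative_eq_intros)
  moreover have "(l has_derivative (\<lambda>h. h \<bullet> D)) (at (x + t *\<^sub>R h))"
    using assms by (simp add: gderiv_def)
  ultimately have "((\<lambda>t. l (x + t *\<^sub>R h)) has_derivative (\<lambda>s. (s *\<^sub>R h) \<bullet> D)) (at t)"
    by (rule has_derivative_compose)
  then show ?thesis
    by (simp add: has_field_derivative_def mult.commute[of _ "h \<bullet> D"])
qed

text \<open>Restricting \<open>l\<close> to the line through \<open>x\<close> and \<open>y\<close>
  reduces this to the tangent inequality for convex functions of one real variable.\<close>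

lemma convex_on_imp_above_gradient:
  assumes convex: "convex_on UNIV l" and D: "GDERIV l x :> D"
  shows "l x + D \<bullet> (y - x) \<le> l y"
proof -
  define \<phi> where "\<phi> t = l (x + t *\<^sub>R (y - x))" for t :: real
  have "convex_on UNIV \<phi>"
  proof (rule convex_onI)
    fix t a b :: real
    assume t: "0 < t" "t < 1"
    have "x + ((1 - t) *\<^sub>R a + t *\<^sub>R b) *\<^sub>R (y - x)
        = (1 - t) *\<^sub>R (x + a *\<^sub>R (y - x)) + t *\<^sub>R (x + b *\<^sub>R (y - x))"
      by (simp add: algebra_simps)
    then show "\<phi> ((1 - t) *\<^sub>R a + t *\<^sub>R b) \<le> (1 - t) * \<phi> a + t * \<phi> b"
      using convex_onD[OF convex, of t] t by (simp add: \<phi>_def)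
  qed simp
  moreover have "(\<phi> has_real_derivative (y - x) \<bullet> D) (at 0)"
    unfolding \<phi>_def by (rule GDERIV_along_line) (simp add: D)
  ultimately have "\<phi> 1 - \<phi> 0 \<ge> ((y - x) \<bullet> D) * (1 - 0)"
    by (intro convex_on_imp_above_tangent[where A = UNIV]) auto
  then show ?thesis
    by (simp add: \<phi>_def inner_commute)
qed

text \<open>\<open>\<phi>\<close> is \<open>l\<close> along the segment minus the linear and
  quadratic terms of the bound. Cauchy-Schwarz and the Lipschitz condition make its derivative
  nonpositive on [0, 1], so no integral of the gradient is needed.\<close>

lemma descent_lemma:
  fixes g :: "'a::real_inner \<Rightarrow> 'a"
  assumes D: "\<And>x. GDERIV l x :> g x" and lip: "L-lipschitz_on UNIV g"
  shows "l y \<le> l x + g x \<bullet> (y - x) + L / 2 * (norm (y - x))\<^sup>2"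
proof -
  define h where "h = y - x"
  define \<phi> where "\<phi> t = l (x + t *\<^sub>R h) - t * (h \<bullet> g x) - L / 2 * t\<^sup>2 * (norm h)\<^sup>2" for t
  have "\<phi> 1 \<le> \<phi> 0"
  proof (rule DERIV_nonpos_imp_nonincreasing[of 0 1 \<phi>])
    fix t :: real
    assume t: "0 \<le> t" "t \<le> 1"
    have "(\<phi> has_real_derivative h \<bullet> g (x + t *\<^sub>R h) - h \<bullet> g x - L * t * (norm h)\<^sup>2) (at t)"
      unfolding \<phi>_def by (auto intro!: derivative_eq_intros GDERIV_along_line D)
    moreover have "h \<bullet> g (x + t *\<^sub>R h) - h \<bullet> g x \<le> L * t * (norm h)\<^sup>2"
    proof -
      have "h \<bullet> (g (x + t *\<^sub>R h) - g x) \<le> norm h * norm (g (x + t *\<^sub>R h) - g x)"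
        by (rule norm_cauchy_schwarz)
      also have "\<dots> \<le> norm h * (L * norm (t *\<^sub>R h))"
        using lipschitz_onD[OF lip, of "x + t *\<^sub>R h" x]
        by (intro mult_left_mono) (auto simp: dist_norm)
      finally show ?thesis
        using t by (simp add: inner_diff_right power2_eq_square mult_ac)
    qed
    ultimately show "\<exists>y. (\<phi> has_real_derivative y) (at t) \<and> y \<le> 0"
      by (intro exI conjI) auto
  qed simp
  then show ?thesis
    by (simp add: \<phi>_def h_def inner_commute)
qed

text \<open>The tilted function \<open>\<lambda>v. l v - g x \<bullet> v\<close> is minimal at \<open>x\<close>; compare that minimum with the
  descent lemma for a gradient step of length \<open>1 / L\<close> started at \<open>y\<close>.\<close>

lemma convex_smooth_lower_bound:
  fixes g :: "'a::real_inner \<Rightarrow> 'a"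
  assumes convex: "convex_on UNIV l" and D: "\<And>x. GDERIV l x :> g x"
    and lip: "L-lipschitz_on UNIV g" and L: "L > 0"
  shows "l x + g x \<bullet> (y - x) + (norm (g y - g x))\<^sup>2 / (2 * L) \<le> l y"
proof -
  define v where "v = g y - g x"
  define w where "w = y - (1 / L) *\<^sub>R v"
  have "l x + g x \<bullet> (w - x) \<le> l w"
    by (rule convex_on_imp_above_gradient[OF convex D])
  also have "l w \<le> l y + g y \<bullet> (w - y) + L / 2 * (norm (w - y))\<^sup>2"
    by (rule descent_lemma[OF D lip])
  finally have "l x + g x \<bullet> (w - x) \<le> l y + g y \<bullet> (w - y) + L / 2 * (norm (w - y))\<^sup>2" .
  moreover have "g x \<bullet> (w - x) = g x \<bullet> (y - x) - g x \<bullet> v / L"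
    by (simp add: w_def inner_diff_right)
  \<comment> \<open>The terms in \<open>g x \<bullet> v\<close> will cancel. The quadratic term
    gives back half of the loss \<open>(norm v)\<^sup>2 / L\<close>, which leaves the factor
    \<open>1 / (2 * L)\<close>.\<close>
  moreover have "g y \<bullet> (w - y) = - (g x \<bullet> v / L) - (norm v)\<^sup>2 / L"
  proof -
    have "g y = g x + v" by (simp add: v_def)
    then show ?thesis
      by (simp add: w_def inner_add_left power2_norm_eq_inner add_divide_distrib)
  qed
  moreover have "L / 2 * (norm (w - y))\<^sup>2 = (norm v)\<^sup>2 / L / 2"
    using L by (simp add: w_def power2_eq_square)
  ultimately show ?thesis
    by (simp add: v_def)
qed

text \<open>Add the preceding lower bound to itself with \<open>x\<close> and \<open>y\<close>
  exchanged: the values of \<open>l\<close> cancel and the two halves make up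
  \<open>1 / L\<close>.\<close>

lemma Baillon_Haddad:
  fixes g :: "'a::real_inner \<Rightarrow> 'a"
  assumes "convex_on UNIV l" and "\<And>x. GDERIV l x :> g x"
    and "L-lipschitz_on UNIV g" and "L > 0"
  shows "(norm (g x - g y))\<^sup>2 / L \<le> (g x - g y) \<bullet> (x - y)"
proof -
  have "(g x - g y) \<bullet> (x - y) = - (g x \<bullet> (y - x)) - g y \<bullet> (x - y)"
    by (simp add: inner_diff_left inner_diff_right)
  moreover have "(norm (g x - g y))\<^sup>2 / L = 2 * ((norm (g x - g y))\<^sup>2 / (2 * L))"
    by simp
  ultimately show ?thesis
    using convex_smooth_lower_bound[OF assms, of x y] convex_smooth_lower_bound[OF assms, of y x]
    unfolding norm_minus_commute[of "g y" "g x"] by linarith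
qed

text \<open>Expand the square; since \<open>g z = 0\<close>, cocoercivity bounds the cross term by a
  multiple of \<open>(norm (g x))\<^sup>2\<close>.\<close>

lemma gradient_step_decrease:
  fixes g :: "'a::real_inner \<Rightarrow> 'a"
  assumes "convex_on UNIV l" and "\<And>x. GDERIV l x :> g x"
    and "L-lipschitz_on UNIV g" and "L > 0" and "0 \<le> \<mu>" and z: "g z = 0"
  shows "(norm (x - \<mu> *\<^sub>R g x - z))\<^sup>2 \<le> (norm (x - z))\<^sup>2 - \<mu> * (2 / L - \<mu>) * (norm (g x))\<^sup>2"
proof -
  have "(norm (x - \<mu> *\<^sub>R g x - z))\<^sup>2
      = (norm (x - z))\<^sup>2 - 2 * (\<mu> * (g x \<bullet> (x - z))) + \<mu>\<^sup>2 * (norm (g x))\<^sup>2"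
    unfolding power2_norm_eq_inner
    by (simp add: inner_diff_left inner_diff_right inner_commute algebra_simps power2_eq_square)
  moreover have "\<mu> * ((norm (g x))\<^sup>2 / L) \<le> \<mu> * (g x \<bullet> (x - z))"
    using Baillon_Haddad[OF assms(1-4), of x z] z \<open>0 \<le> \<mu>\<close> by (intro mult_left_mono) auto
  moreover have "\<mu> * (2 / L - \<mu>) * (norm (g x))\<^sup>2
      = 2 * (\<mu> * ((norm (g x))\<^sup>2 / L)) - \<mu>\<^sup>2 * (norm (g x))\<^sup>2"
    by (simp add: algebra_simps power2_eq_square)
  ultimately show ?thesis
    by linarith
qed

text \<open>Expanding the square turns demicontractivity into an upper bound on the inner product of
  \<open>y - z\<close> and \<open>f y - y\<close>. This controls the part linear in \<alpha>; only
  the \<alpha>-squared term works against the decrease.\<close>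

lemma relaxation_decrease:
  fixes f :: "'a::real_inner \<Rightarrow> 'a"
  assumes demi: "demicontractive d f" and z: "z \<in> Fix f" and "0 \<le> \<alpha>"
  shows "(norm (relaxation \<alpha> f y - z))\<^sup>2
    \<le> (norm (y - z))\<^sup>2 - \<alpha> * (1 - d - \<alpha>) * (norm (f y - y))\<^sup>2"
proof -
  define u v where "u = y - z" and "v = f y - y"
  have "(norm (u + v))\<^sup>2 \<le> (norm u)\<^sup>2 + d * (norm v)\<^sup>2"
    using demi z by (simp add: demicontractive_def u_def v_def)
  then have "2 * (u \<bullet> v) \<le> (d - 1) * (norm v)\<^sup>2"
    unfolding power2_norm_eq_inner
    by (simp add: inner_add_left inner_add_right inner_commute algebra_simps)
  then have "\<alpha> * (2 * (u \<bullet> v)) \<le> \<alpha> * ((d - 1) * (norm v)\<^sup>2)"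
    using \<open>0 \<le> \<alpha>\<close> by (rule mult_left_mono)
  moreover have "(norm (u + \<alpha> *\<^sub>R v))\<^sup>2 = (norm u)\<^sup>2 + \<alpha> * (2 * (u \<bullet> v)) + \<alpha>\<^sup>2 * (norm v)\<^sup>2"
    unfolding power2_norm_eq_inner
    by (simp add: inner_add_left inner_add_right inner_commute algebra_simps power2_eq_square)
  moreover have "relaxation \<alpha> f y - z = u + \<alpha> *\<^sub>R v"
    by (simp add: relaxation_def u_def v_def algebra_simps)
  moreover have "\<alpha> * (1 - d - \<alpha>) * (norm v)\<^sup>2
      = - (\<alpha> * ((d - 1) * (norm v)\<^sup>2)) - \<alpha>\<^sup>2 * (norm v)\<^sup>2"
    by (simp add: algebra_simps power2_eq_square)
  ultimately have "(norm (relaxation \<alpha> f y - z))\<^sup>2 \<le> (norm u)\<^sup>2 - \<alpha> * (1 - d - \<alpha>) * (norm v)\<^sup>2"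
    by simp
  then show ?thesis
    by (simp add: u_def v_def)
qed

text \<open>A decreasing sequence bounded below converges, so its successive differences vanish, and
  they dominate \<open>b\<close>.\<close>

lemma telescoping_decrease_tendsto_0:
  fixes a b :: "nat \<Rightarrow> real"
  assumes step: "\<And>k. a (Suc k) \<le> a k - b k" and "\<And>k. 0 \<le> a k" and b: "\<And>k. 0 \<le> b k"
  shows "b \<longlonglongrightarrow> 0"
proof -
  have "decseq a"
  proof (rule decseq_SucI)
    show "a (Suc k) \<le> a k" for k
      using step[of k] b[of k] by linarith
  qed
  then obtain c where c: "a \<longlonglongrightarrow> c"
    by (rule decseq_convergent[of a 0]) (use assms(2) in auto)
  have "(\<lambda>k. a k - a (Suc k)) \<longlonglongrightarrow> c - c"
    by (intro tendsto_diff c LIMSEQ_Suc)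
  then have lim: "(\<lambda>k. a k - a (Suc k)) \<longlonglongrightarrow> 0" by simp
  show ?thesis
    by (rule tendsto_sandwich[OF _ _ tendsto_const lim])
       (use b step in \<open>auto simp: algebra_simps intro!: always_eventually\<close>)
qed

text \<open>Serves to extract each single residual from the weighted sum of both.\<close>

lemma weighted_square_tendsto_0_imp_tendsto_0:
  fixes u :: "nat \<Rightarrow> 'a::real_normed_vector"
  assumes "c > 0" and le: "\<And>k. c * (norm (u k))\<^sup>2 \<le> b k" and b: "b \<longlonglongrightarrow> 0"
  shows "u \<longlonglongrightarrow> 0"
proof -
  have "(\<lambda>k. (norm (u k))\<^sup>2) \<longlonglongrightarrow> 0"
    by (rule tendsto_sandwich[OF _ _ tendsto_const tendsto_divide_zero[OF b, of c]])
       (use le \<open>c > 0\<close> in \<open>auto simp: pos_le_divide_eq mult.commute intro!: always_eventually\<close>)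
  then have "(\<lambda>k. sqrt ((norm (u k))\<^sup>2)) \<longlonglongrightarrow> sqrt 0"
    by (rule tendsto_real_sqrt)
  then show ?thesis
    by (simp add: tendsto_norm_zero_iff)
qed

text \<open>Monotonicity makes the distances to \<open>p\<close> converge; the subsequence
  identifies their limit as 0.\<close>

lemma Fejer_subsequence_imp_tendsto:
  fixes x :: "nat \<Rightarrow> 'a::metric_space"
  assumes Fejer: "\<And>k. dist (x (Suc k)) p \<le> dist (x k) p"
    and r: "strict_mono r" and lim: "(x \<circ> r) \<longlonglongrightarrow> p"
  shows "x \<longlonglongrightarrow> p"
proof -
  have "decseq (\<lambda>k. dist (x k) p)"
    using Fejer by (rule decseq_SucI)
  then obtain c where c: "(\<lambda>k. dist (x k) p) \<longlonglongrightarrow> c"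
    by (rule decseq_convergent[of _ 0]) auto
  have "(\<lambda>k. dist (x (r k)) p) \<longlonglongrightarrow> c"
    using LIMSEQ_subseq_LIMSEQ[OF c r] by (simp add: o_def)
  moreover have "(\<lambda>k. dist (x (r k)) p) \<longlonglongrightarrow> 0"
    using iffD1[OF tendsto_dist_iff lim] by (simp add: o_def)
  ultimately have "c = 0"
    by (rule LIMSEQ_unique)
  with c show ?thesis
    using iffD2[OF tendsto_dist_iff] by blast
qed

theorem theorem4p4:
  fixes f :: "real ^ 'n \<Rightarrow> real ^ 'n" and l :: "real ^ 'n \<Rightarrow> real"
    and d L \<alpha> \<mu> :: real and x0 :: "real ^ 'n" and x :: "nat \<Rightarrow> real ^ 'n"
  assumes f_cont: "continuous_on UNIV f"
    and d: "d \<in> {0..<1}"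
    and f_demi: "demicontractive d f"
    and l_proper: "proper_fun (\<lambda>y. ereal (l y))"
    and l_convex: "convex_on UNIV l"
    and l_lsc: "lower_semicontinuous (\<lambda>y. ereal (l y))"
    and l_diff: "l differentiable_on UNIV"
    and L: "L > 0"
    and l_lipschitz: "L-lipschitz_on UNIV (gradient l)"
    and alpha: "\<alpha> \<in> {0<..<(1 - d) / 2}"
    and mu: "\<mu> \<in> {0<..<2 / L}"
    and common_fix: "Fix f \<inter> Fix (gradient_step \<mu> l) \<noteq> {}"
    and x_0: "x 0 = x0"
    and x_Suc: "\<And>k. x (Suc k) = relaxation \<alpha> f (x k - \<mu> *\<^sub>R gradient l (x k))"
  shows "\<exists>xs. is_arg_min l (\<lambda>y. y \<in> Fix f) xs \<and> x \<longlonglongrightarrow> xs"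
proof -
  define g where "g = gradient l"
  define y where "y k = x k - \<mu> *\<^sub>R g (x k)" for k
  define c1 c2 where "c1 = \<mu> * (2 / L - \<mu>)" and "c2 = \<alpha> * (1 - d - \<alpha>)"
  have D: "GDERIV l v :> g v" for v
    using l_diff unfolding g_def by (intro gradient_works) (simp add: differentiable_on_def)
  have lip: "L-lipschitz_on UNIV g"
    using l_lipschitz by (simp add: g_def)
  \<comment> \<open>Here \<open>1 - d - \<alpha>\<close> exceeds \<open>(1 - d) / 2\<close>, which
    is positive.\<close>
  have "c1 > 0" and "c2 > 0"
    using mu alpha d by (auto simp: c1_def c2_def intro!: mult_pos_pos)
  have x_Suc': "x (Suc k) = relaxation \<alpha> f (y k)" for k
    by (simp add: x_Suc y_def g_def)
  have fix_G: "z \<in> Fix (gradient_step \<mu> l) \<longleftrightarrow> g z = 0" for z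
    using mu by (simp add: Fix_def gradient_step_def g_def)
  have decrease: "(norm (x (Suc k) - z))\<^sup>2
      \<le> (norm (x k - z))\<^sup>2 - (c1 * (norm (g (x k)))\<^sup>2 + c2 * (norm (f (y k) - y k))\<^sup>2)"
    if "z \<in> Fix f" "g z = 0" for z k
    using relaxation_decrease[OF f_demi that(1), of \<alpha> "y k"]
      gradient_step_decrease[OF l_convex D lip L _ that(2), of \<mu> "x k"] alpha mu
    by (simp add: x_Suc' c1_def c2_def y_def)
  \<comment> \<open>Kept general in \<open>z\<close>: it is applied to the given common fixed point
    for boundedness, and later to the cluster point.\<close>
  have Fejer: "dist (x (Suc k)) z \<le> dist (x k) z" if "z \<in> Fix f" "g z = 0" for z k
  proof -
    have "0 \<le> c1 * (norm (g (x k)))\<^sup>2 + c2 * (norm (f (y k) - y k))\<^sup>2"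
      using \<open>c1 > 0\<close> \<open>c2 > 0\<close> by simp
    with decrease[OF that, of k] have "(norm (x (Suc k) - z))\<^sup>2 \<le> (norm (x k - z))\<^sup>2"
      by linarith
    then show ?thesis
      by (simp add: dist_norm)
  qed
  obtain z where z: "z \<in> Fix f" "g z = 0"
    using common_fix fix_G by blast
  have residuals: "(\<lambda>k. c1 * (norm (g (x k)))\<^sup>2 + c2 * (norm (f (y k) - y k))\<^sup>2) \<longlonglongrightarrow> 0"
    by (rule telescoping_decrease_tendsto_0[where a = "\<lambda>k. (norm (x k - z))\<^sup>2"])
       (use decrease[OF z] \<open>c1 > 0\<close> \<open>c2 > 0\<close> in auto)
  have g_lim: "(\<lambda>k. g (x k)) \<longlonglongrightarrow> 0"
    by (rule weighted_square_tendsto_0_imp_tendsto_0[OF \<open>c1 > 0\<close> _ residuals])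
       (use \<open>c2 > 0\<close> in simp)
  have f_lim: "(\<lambda>k. f (y k) - y k) \<longlonglongrightarrow> 0"
    by (rule weighted_square_tendsto_0_imp_tendsto_0[OF \<open>c2 > 0\<close> _ residuals])
       (use \<open>c1 > 0\<close> in simp)
  have "dist (x k) z \<le> dist (x 0) z" for k
    using Fejer[OF z] by (induction k) (auto intro: order_trans)
  then have "bounded (range x)"
    by (auto simp: bounded_any_center[of _ z] dist_commute)
  then obtain p r where r: "strict_mono r" and lim: "(x \<circ> r) \<longlonglongrightarrow> p"
    using bounded_imp_convergent_subsequence by blast
  have x_lim: "(\<lambda>k. x (r k)) \<longlonglongrightarrow> p"
    using lim by (simp add: o_def)
  have g_lim': "(\<lambda>k. g (x (r k))) \<longlonglongrightarrow> 0"
    using LIMSEQ_subseq_LIMSEQ[OF g_lim r] by (simp add: o_def)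
  have "(\<lambda>k. g (x (r k))) \<longlonglongrightarrow> g p"
    by (rule continuous_on_tendsto_compose[OF lipschitz_on_continuous_on[OF lip] x_lim]) auto
  then have gp: "g p = 0"
    using g_lim' LIMSEQ_unique by blast
  \<comment> \<open>The residual of \<open>f\<close> is measured at \<open>y k\<close>, not at
    \<open>x k\<close>; the vanishing gradient transfers the limit from one to the other.\<close>
  have "(\<lambda>k. x (r k) - \<mu> *\<^sub>R g (x (r k))) \<longlonglongrightarrow> p - \<mu> *\<^sub>R 0"
    by (intro tendsto_intros x_lim g_lim')
  then have y_lim: "(\<lambda>k. y (r k)) \<longlonglongrightarrow> p"
    by (simp add: y_def)
  have "(\<lambda>k. f (y (r k)) - y (r k)) \<longlonglongrightarrow> f p - p"
    by (intro tendsto_diff y_lim continuous_on_tendsto_compose[OF f_cont y_lim]) auto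
  moreover have "(\<lambda>k. f (y (r k)) - y (r k)) \<longlonglongrightarrow> 0"
    using LIMSEQ_subseq_LIMSEQ[OF f_lim r] by (simp add: o_def)
  ultimately have "f p - p = 0"
    by (rule LIMSEQ_unique)
  then have p: "p \<in> Fix f"
    by (simp add: Fix_def)
  have "x \<longlonglongrightarrow> p"
    by (rule Fejer_subsequence_imp_tendsto[OF Fejer[OF p gp] r lim])
  \<comment> \<open>With zero gradient the supporting hyperplane at \<open>p\<close> is horizontal,
    so \<open>p\<close> minimises \<open>l\<close> over the whole space.\<close>
  moreover have "l p \<le> l v" for v
    using convex_on_imp_above_gradient[OF l_convex D, of p v] gp by simp
  then have "is_arg_min l (\<lambda>y. y \<in> Fix f) p"
    using p by (auto simp: is_arg_min_linorder)
  ultimately show ?thesis by blast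
qed

end
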